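(* Let $(\mathcal{X}\times\mathcal{Y}\times\mathcal{Z},\mathcal{F},\mathcal{P}_{XYZ})$ be a probability space, let $\mathcal{P}_Z$ be the marginal distribution of $Z$ and let $\mathcal{P}_{Y|Z}$ and $\mathcal{P}_{X|Z}$ be the induced conditional distributions. Assume that $\mathcal{P}_{XYZ}\ll\mathcal{P}_Z\mathcal{P}_{Y|Z}\mathcal{P}_{X|Z}$. Given $E\in\mathcal{F}$ and $z\in\mathcal{Z}$, let $E_z=\{(x,y):(x,y,z)\in E\}$. Then, for every fixed $\alpha\geq 1$, $$\mathcal{P}_{XYZ}(E)\leq \operatorname*{ess\,sup}_{\mathcal{P}_Z}\left(\mathcal{P}_{X|Z}\mathcal{P}_{Y|Z}(E_Z)\right)^{\frac{\alpha-1}{\alpha}}\cdot\exp\left(\frac{\alpha-1}{\alpha}I_\alpha^Z(X,Y|Z)\right).$$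
   Context: $X,Y,Z$ are the coordinate random variables, jointly distributed according to $\mathcal{P}_{XYZ}$. $\mathcal{P}_Z\mathcal{P}_{Y|Z}\mathcal{P}_{X|Z}$ denotes the measure under which $Z\sim\mathcal{P}_Z$ and, given $Z$, $X$ and $Y$ are independent with conditional laws $\mathcal{P}_{X|Z}$ and $\mathcal{P}_{Y|Z}$. $\mathcal{P}_{X|Z=z}\mathcal{P}_{Y|Z=z}(E_z)$ is the probability of $E_z$ under the product measure $\mathcal{P}_{X|Z=z}\otimes\mathcal{P}_{Y|Z=z}$, and $\operatorname{ess\,sup}_{\mathcal{P}_Z}$ is the essential supremum over $z$ with respect to $\mathcal{P}_Z$. Rényi divergence: for $\alpha>0$, $\alpha\neq 1$, and probability measures $\mathcal{P},\mathcal{Q}$ with densities $p,q$ with respect to a common dominating measure $\mu$, $D_\alpha(\mathcal{P}\|\mathcal{Q})=\frac{1}{\alpha-1}\log\int p^\alpha q^{1-\alpha}\,d\mu$ ($=+\infty$ if $\alpha>1$ and $\mathcal{P}\not\ll\mathcal{Q}$); $D_1$ is the Kullback–Leibler divergence. $\log$ is the natural logarithm. Definition: $I^{Z}_\alpha(X,Y|Z)=\min_{\mathcal{Q}_{Z}} D_\alpha(\mathcal{P}_{XYZ}\|\mathcal{P}_{X|Z}\mathcal{P}_{Y|Z}\mathcal{Q}_Z)$, the minimum being over all probability measures $\mathcal{Q}_Z$ on $\mathcal{Z}$. *)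

theory Defs
  imports "HOL-Probability.Probability"
begin

section \<open>Powers, exponential and logarithm\<close>

text \<open>The library's \<^const>\<open>powr\<close> has \<open>0 powr 0 = 0\<close>; here the convention is \<open>0\<^sup>0 = 1\<close>.\<close>

definition rpow :: "real \<Rightarrow> real \<Rightarrow> real" where
  "rpow x a = (if a = 0 then 1 else x powr a)"

definition eexp :: "ereal \<Rightarrow> ennreal" where
  "eexp x = (case x of ereal r \<Rightarrow> ennreal (exp r) | PInfty \<Rightarrow> \<infinity> | MInfty \<Rightarrow> 0)"

definition eln :: "ennreal \<Rightarrow> ereal" where
  "eln x = (if x = 0 then - \<infinity> else if x = \<infinity> then \<infinity> else ereal (ln (enn2real x)))"


section \<open>Renyi divergence\<close>

definition sum_measure :: "'a measure \<Rightarrow> 'a measure \<Rightarrow> 'a measure" where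
  "sum_measure P Q = measure_of (space P) (sets P) (\<lambda>A. emeasure P A + emeasure Q A)"

lemma sets_sum_measure [simp, measurable_cong]: "sets (sum_measure P Q) = sets P"
  and space_sum_measure [simp]: "space (sum_measure P Q) = space P"
  by (simp_all add: sum_measure_def)

lemma emeasure_sum_measure:
  assumes "sets Q = sets P" "A \<in> sets P"
  shows "emeasure (sum_measure P Q) A = emeasure P A + emeasure Q A"
proof (rule emeasure_measure_of[OF sum_measure_def])
  show "sets P \<subseteq> Pow (space P)" by (rule sets.space_closed)
  show "A \<in> sets (sum_measure P Q)" using assms by simp
  show "positive (sets (sum_measure P Q)) (\<lambda>A. emeasure P A + emeasure Q A)"
    by (simp add: positive_def)
  show "countably_additive (sets (sum_measure P Q)) (\<lambda>A. emeasure P A + emeasure Q A)"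
    unfolding countably_additive_def sets_sum_measure
  proof safe
    fix F :: "nat \<Rightarrow> _" assume "range F \<subseteq> sets P" "disjoint_family F"
    then show "(\<Sum>i. emeasure P (F i) + emeasure Q (F i))
        = emeasure P (\<Union>(range F)) + emeasure Q (\<Union>(range F))"
      using assms by (simp add: suminf_add[symmetric] suminf_emeasure)
  qed
qed

text \<open>
  The common dominating measure is fixed to \<open>P + Q\<close>; lemma \<open>renyi_divergence_density\<close> below shows
  that any other choice gives the same value. The densities are finite almost everywhere, so
  \<^const>\<open>enn2real\<close> loses nothing. Where the second density vanishes, the integrand is \<open>0\<close>
  because \<open>0 powr (1 - \<alpha>) = 0\<close>. For \<open>\<alpha> > 1\<close> and \<open>P\<close> absolutely continuous with respect to \<open>Q\<close>
  this concerns only a null set.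

  For \<open>\<alpha> = 1\<close>, \<^term>\<open>KL_divergence b Q P\<close> is the divergence of \<open>P\<close> from \<open>Q\<close>. When \<open>P\<close> is
  absolutely continuous with respect to \<open>Q\<close>, the negative part of the entropy density is always
  \<open>P\<close>-integrable, so non-integrability means that the divergence is \<open>\<infinity>\<close>.
\<close>

definition renyi_divergence :: "real \<Rightarrow> 'a measure \<Rightarrow> 'a measure \<Rightarrow> ereal" where
  "renyi_divergence \<alpha> P Q =
    (if \<alpha> = 1 then
       (if absolutely_continuous Q P \<and> integrable P (entropy_density (exp 1) Q P)
        then ereal (KL_divergence (exp 1) Q P) else \<infinity>)
     else if \<alpha> > 1 \<and> \<not> absolutely_continuous Q P then \<infinity>
     else (let \<mu> = sum_measure P Q;
               p = (\<lambda>w. enn2real (RN_deriv \<mu> P w));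
               q = (\<lambda>w. enn2real (RN_deriv \<mu> Q w))
           in ereal (1 / (\<alpha> - 1)) * eln (\<integral>\<^sup>+w. ennreal (p w powr \<alpha> * q w powr (1 - \<alpha>)) \<partial>\<mu>)))"

lemma renyi_divergence_density:
  fixes p q :: "'a \<Rightarrow> real"
  assumes \<mu>: "sigma_finite_measure \<mu>"
    and [measurable]: "p \<in> borel_measurable \<mu>" "q \<in> borel_measurable \<mu>"
    and nonneg: "\<And>w. 0 \<le> p w" "\<And>w. 0 \<le> q w"
    and P: "P = density \<mu> p" "prob_space P" and Q: "Q = density \<mu> q" "prob_space Q"
    and \<alpha>: "\<alpha> \<noteq> 1"
  shows "renyi_divergence \<alpha> P Q =
    (if \<alpha> > 1 \<and> \<not> absolutely_continuous Q P then \<infinity>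
     else ereal (1 / (\<alpha> - 1)) * eln (\<integral>\<^sup>+w. ennreal (p w powr \<alpha> * q w powr (1 - \<alpha>)) \<partial>\<mu>))"
proof -
  interpret \<mu>: sigma_finite_measure \<mu> by fact
  interpret P: prob_space P by fact
  interpret Q: prob_space Q by fact
  define \<nu> where "\<nu> = sum_measure P Q"
  define s where "s w = p w + q w" for w
  have [measurable]: "s \<in> borel_measurable \<mu>" unfolding s_def by measurable
  have [measurable_cong, simp]: "sets \<nu> = sets \<mu>" by (simp add: \<nu>_def P)
  have spQ: "sets Q = sets P" by (simp add: P Q)
  have \<nu>: "\<nu> = density \<mu> (\<lambda>w. ennreal (s w))"
  proof (rule measure_eqI)
    fix A assume "A \<in> sets \<nu>"
    then have [measurable]: "A \<in> sets \<mu>" by simp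
    have "emeasure \<nu> A = emeasure P A + emeasure Q A"
      unfolding \<nu>_def by (rule emeasure_sum_measure[OF spQ]) (simp add: P)
    also have "\<dots> = (\<integral>\<^sup>+w. ennreal (p w) * indicator A w + ennreal (q w) * indicator A w \<partial>\<mu>)"
      by (simp add: P Q emeasure_density nn_integral_add)
    also have "\<dots> = emeasure (density \<mu> (\<lambda>w. ennreal (s w))) A"
      by (simp add: emeasure_density s_def nonneg distrib_right)
    finally show "emeasure \<nu> A = emeasure (density \<mu> (\<lambda>w. ennreal (s w))) A" .
  qed simp
  have fin: "finite_measure \<nu>"
  proof
    have "emeasure \<nu> (space P) = emeasure P (space P) + emeasure Q (space P)"
      unfolding \<nu>_def by (rule emeasure_sum_measure[OF spQ]) simp
    then show "emeasure \<nu> (space \<nu>) \<noteq> \<infinity>"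
      by (simp add: \<nu>_def P.emeasure_finite Q.emeasure_finite)
  qed
  interpret \<nu>: finite_measure \<nu> by (rule fin)
  have ac: "absolutely_continuous \<nu> P" "absolutely_continuous \<nu> Q"
    using emeasure_sum_measure[OF spQ] spQ
    by (auto simp: absolutely_continuous_def null_sets_def \<nu>_def)
  define f where "f = RN_deriv \<nu> P"
  define g where "g = RN_deriv \<nu> Q"
  have [measurable]: "f \<in> borel_measurable \<mu>" "g \<in> borel_measurable \<mu>"
    using borel_measurable_RN_deriv[of \<nu> P] borel_measurable_RN_deriv[of \<nu> Q]
    by (simp_all add: f_def g_def cong: measurable_cong_sets)
  have "sets P = sets \<nu>" "sets Q = sets \<nu>" using spQ by (simp_all add: \<nu>_def)
  then have fg: "density \<nu> f = P" "density \<nu> g = Q"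
    unfolding f_def g_def using ac by (auto intro: \<nu>.density_RN_deriv)
  have "density \<mu> (\<lambda>w. ennreal (s w) * f w) = density \<nu> f"
    "density \<mu> (\<lambda>w. ennreal (s w) * g w) = density \<nu> g"
    unfolding \<nu> by (rule density_density_eq[symmetric]; measurable)+
  then have d: "density \<mu> (\<lambda>w. ennreal (s w) * f w) = density \<mu> p"
    "density \<mu> (\<lambda>w. ennreal (s w) * g w) = density \<mu> q"
    unfolding fg P(1)[symmetric] Q(1)[symmetric] by simp_all
  have ae: "AE w in \<mu>. ennreal (s w) * f w = ennreal (p w)"
    "AE w in \<mu>. ennreal (s w) * g w = ennreal (q w)"
    by (rule \<mu>.density_unique; (rule d | measurable))+
  have conv: "s w * enn2real h = r" if "ennreal (s w) * h = ennreal r" "0 \<le> r" for h r w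
  proof -
    have "enn2real (ennreal (s w) * h) = r" using that by simp
    moreover have "0 \<le> s w" by (simp add: s_def nonneg)
    ultimately show ?thesis by (simp add: enn2real_mult)
  qed
  have "(\<integral>\<^sup>+w. ennreal (enn2real (f w) powr \<alpha> * enn2real (g w) powr (1 - \<alpha>)) \<partial>\<nu>)
     = (\<integral>\<^sup>+w. ennreal (s w) * ennreal (enn2real (f w) powr \<alpha> * enn2real (g w) powr (1 - \<alpha>)) \<partial>\<mu>)"
    unfolding \<nu> by (rule nn_integral_density) measurable
  also have "\<dots> = (\<integral>\<^sup>+w. ennreal (p w powr \<alpha> * q w powr (1 - \<alpha>)) \<partial>\<mu>)"
  proof (rule nn_integral_cong_AE)
    show "AE w in \<mu>. ennreal (s w) * ennreal (enn2real (f w) powr \<alpha> * enn2real (g w) powr (1 - \<alpha>))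
        = ennreal (p w powr \<alpha> * q w powr (1 - \<alpha>))"
      using ae
    proof eventually_elim
      case (elim w)
      have e: "p w = s w * enn2real (f w)" "q w = s w * enn2real (g w)"
        using conv[OF elim(1) nonneg(1)] conv[OF elim(2) nonneg(2)] by simp_all
      have s0: "0 \<le> s w" by (simp add: s_def nonneg)
      have "s w = s w powr \<alpha> * s w powr (1 - \<alpha>)"
        using s0 by (simp add: powr_add[symmetric])
      then have "s w * (enn2real (f w) powr \<alpha> * enn2real (g w) powr (1 - \<alpha>))
          = p w powr \<alpha> * q w powr (1 - \<alpha>)"
        unfolding e using s0 by (simp add: powr_mult)
      then show ?case using s0 by (simp add: ennreal_mult''[symmetric])
    qed
  qed
  finally show ?thesis
    using \<alpha> by (simp add: renyi_divergence_def Let_def f_def g_def \<nu>_def)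
qed


section \<open>Conditional distributions and conditional information\<close>

text \<open>\<open>K\<close> is a (regular) conditional distribution of \<open>X\<close> given \<open>Z\<close> under \<open>P\<close>.\<close>

definition cond_distribution ::
    "'w measure \<Rightarrow> 'a measure \<Rightarrow> ('w \<Rightarrow> 'a) \<Rightarrow> 'z measure \<Rightarrow> ('w \<Rightarrow> 'z) \<Rightarrow> ('z \<Rightarrow> 'a measure) \<Rightarrow> bool"
  where
  "cond_distribution P MX X MZ Z K \<longleftrightarrow>
     K \<in> MZ \<rightarrow>\<^sub>M prob_algebra MX \<and>
     (\<forall>A\<in>sets MX. \<forall>C\<in>sets MZ.
        emeasure P {w \<in> space P. X w \<in> A \<and> Z w \<in> C}
          = (\<integral>\<^sup>+z\<in>C. emeasure (K z) A \<partial>distr P MZ Z))"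

definition cond_product ::
    "'x measure \<Rightarrow> 'y measure \<Rightarrow> 'z measure \<Rightarrow> ('z \<Rightarrow> 'x measure) \<Rightarrow> ('z \<Rightarrow> 'y measure) \<Rightarrow> 'z measure
      \<Rightarrow> ('x \<times> 'y \<times> 'z) measure"
  where
  "cond_product MX MY MZ KX KY Q =
     Q \<bind> (\<lambda>z. distr (KX z \<Otimes>\<^sub>M KY z) (MX \<Otimes>\<^sub>M MY \<Otimes>\<^sub>M MZ) (\<lambda>(x, y). (x, y, z)))"

lemma
  assumes KX: "KX \<in> MZ \<rightarrow>\<^sub>M prob_algebra MX" and KY: "KY \<in> MZ \<rightarrow>\<^sub>M prob_algebra MY"
    and Q: "prob_space Q" "sets Q = sets MZ"
  shows sets_cond_product: "sets (cond_product MX MY MZ KX KY Q) = sets (MX \<Otimes>\<^sub>M MY \<Otimes>\<^sub>M MZ)"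
    and prob_space_cond_product: "prob_space (cond_product MX MY MZ KX KY Q)"
    and emeasure_cond_product: "E \<in> sets (MX \<Otimes>\<^sub>M MY \<Otimes>\<^sub>M MZ) \<Longrightarrow>
      emeasure (cond_product MX MY MZ KX KY Q) E
        = (\<integral>\<^sup>+z. emeasure (KX z \<Otimes>\<^sub>M KY z) {(x, y). (x, y, z) \<in> E} \<partial>Q)"
proof -
  note [measurable] = KX KY
  let ?M = "MX \<Otimes>\<^sub>M MY \<Otimes>\<^sub>M MZ"
  let ?K = "\<lambda>z. distr (KX z \<Otimes>\<^sub>M KY z) ?M (\<lambda>(x, y). (x, y, z))"
  have Qp: "Q \<in> space (prob_algebra MZ)" using Q by (simp add: space_prob_algebra)
  have K: "?K \<in> MZ \<rightarrow>\<^sub>M prob_algebra ?M"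
    by (rule measurable_distr_prob_space2[where M = "MX \<Otimes>\<^sub>M MY"]) measurable
  have K': "?K \<in> Q \<rightarrow>\<^sub>M subprob_algebra ?M"
    using measurable_prob_algebraD[OF K] Q(2) by (simp cong: measurable_cong_sets)
  have ne: "space Q \<noteq> {}" using Q(1) by (rule prob_space.not_empty)
  show "sets (cond_product MX MY MZ KX KY Q) = sets ?M"
    unfolding cond_product_def using K' ne by (intro sets_bind sets_kernel[OF K']) auto
  show "prob_space (cond_product MX MY MZ KX KY Q)"
    unfolding cond_product_def using prob_space_bind'[OF Qp K] .
  assume E: "E \<in> sets ?M"
  have "emeasure (?K z) E = emeasure (KX z \<Otimes>\<^sub>M KY z) {(x, y). (x, y, z) \<in> E}"
    if "z \<in> space Q" for z
  proof -
    have z: "z \<in> space MZ" using that sets_eq_imp_space_eq[OF Q(2)] by simp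
    have s: "sets (KX z) = sets MX" "sets (KY z) = sets MY"
      using measurable_space[OF KX z] measurable_space[OF KY z] by (simp_all add: space_prob_algebra)
    have sp: "space (KX z \<Otimes>\<^sub>M KY z) = space (MX \<Otimes>\<^sub>M MY)"
      by (rule sets_eq_imp_space_eq) (intro sets_pair_measure_cong s)
    have m: "(\<lambda>(x, y). (x, y, z)) \<in> (KX z \<Otimes>\<^sub>M KY z) \<rightarrow>\<^sub>M ?M"
      using z by (subst measurable_cong_sets[OF sets_pair_measure_cong[OF s] refl]) measurable
    have "(\<lambda>(x, y). (x, y, z)) -` E \<inter> space (KX z \<Otimes>\<^sub>M KY z) = {(x, y). (x, y, z) \<in> E}"
      using sets.sets_into_space[OF E] unfolding sp by (auto simp: space_pair_measure)
    then show ?thesis by (simp add: emeasure_distr[OF m E])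
  qed
  then show "emeasure (cond_product MX MY MZ KX KY Q) E
        = (\<integral>\<^sup>+z. emeasure (KX z \<Otimes>\<^sub>M KY z) {(x, y). (x, y, z) \<in> E} \<partial>Q)"
    unfolding cond_product_def by (subst emeasure_bind[OF ne K' E]) (rule nn_integral_cong)
qed

text \<open>
  The minimum is written as an infimum in the extended reals, which equals the minimum whenever
  the latter exists.
\<close>

definition cond_renyi_info ::
    "'x measure \<Rightarrow> 'y measure \<Rightarrow> 'z measure \<Rightarrow> ('z \<Rightarrow> 'x measure) \<Rightarrow> ('z \<Rightarrow> 'y measure) \<Rightarrow> real
      \<Rightarrow> ('x \<times> 'y \<times> 'z) measure \<Rightarrow> ereal"
  where
  "cond_renyi_info MX MY MZ KX KY \<alpha> P =
     (INF Q \<in> {Q. prob_space Q \<and> sets Q = sets MZ}.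
        renyi_divergence \<alpha> P (cond_product MX MY MZ KX KY Q))"

end

theory Submission
  imports Defs
begin

text \<open>
  Fix \<open>Q\<close>, put \<open>R = P\<^bsub>X|Z\<^esub> P\<^bsub>Y|Z\<^esub> Q\<close> and assume \<open>P \<lless> R\<close>. Hoelder's inequality applied to
  \<open>dP/dR\<close> and the indicator of \<open>A\<close> gives
  \<open>P(A) \<le> R(A) powr ((\<alpha> - 1)/\<alpha>) * exp ((\<alpha> - 1)/\<alpha> * D\<^sub>\<alpha>(P \<parallel> R))\<close>. This is not applied to \<open>E\<close> but to
  the part \<open>A\<close> of \<open>E\<close> over those \<open>z\<close> whose section \<open>E\<^sub>z\<close> has probability at most the
  \<open>P\<^sub>Z\<close>-essential supremum: nothing is lost under \<open>P\<close>, and \<open>R(A)\<close> is bounded by that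
  supremum even if \<open>Q\<close> charges \<open>P\<^sub>Z\<close>-null sets.
\<close>

section \<open>Extended exponential and logarithm\<close>

text \<open>\<open>eln\<close> and \<open>eexp\<close> form a Galois connection, boundary values
  included, so inequalities can be moved across them without case splits.\<close>

lemma eln_le_iff: "eln a \<le> x \<longleftrightarrow> a \<le> eexp x"
proof (cases "a = 0 \<or> a = top")
  case True
  then show ?thesis
    by (cases x) (auto simp: eln_def eexp_def top_unique)
next
  case False
  then obtain r where r: "a = ennreal r" "0 < r"
    by (cases a) (auto simp: less_le)
  have "ln r \<le> y \<longleftrightarrow> r \<le> exp y" for y
    using r exp_le_cancel_iff[of "ln r" y] by simp
  then show ?thesis
    using r by (cases x) (auto simp: eln_def eexp_def ennreal_le_iff ennreal_eq_0_iff not_le)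
qed

text \<open>The infimum need not be attained. Since \<open>s\<close> can be divided out, each bound
  is solved for \<open>D i\<close>; its other side no longer depends on \<open>i\<close>, so it
  passes to the infimum and is then solved back.\<close>

lemma mult_eexp_INF_greatest:
  assumes c: "0 < c" and s: "s \<noteq> 0" "s \<noteq> top"
    and le: "\<And>i. i \<in> I \<Longrightarrow> a \<le> s * eexp (ereal c * D i)"
  shows "a \<le> s * eexp (ereal c * (INF i\<in>I. D i))"
proof -
  have "eln (a / s) / ereal c \<le> D i" if "i \<in> I" for i
  proof -
    have "a / s \<le> eexp (ereal c * D i)"
      using s le[OF that] by (intro divide_le_posI_ennreal) (auto simp: zero_less_iff_neq_zero)
    then show ?thesis
      using c by (simp add: ereal_divide_le_pos eln_le_iff)
  qed
  then have "eln (a / s) / ereal c \<le> (INF i\<in>I. D i)"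
    by (rule INF_greatest)
  then have "a / s \<le> eexp (ereal c * (INF i\<in>I. D i))"
    using c by (simp add: ereal_divide_le_pos eln_le_iff)
  then have "s * (a / s) \<le> s * eexp (ereal c * (INF i\<in>I. D i))"
    by (rule mult_left_mono) simp
  moreover have "s * (a / s) = a"
    using s by (metis ennreal_times_divide mult.commute mult_divide_eq_ennreal)
  ultimately show ?thesis by simp
qed

lemma eexp_0: "eexp 0 = 1"
  by (simp add: eexp_def zero_ereal_def)

lemma eexp_mult_eln:
  assumes "0 < c" "0 \<le> x"
  shows "eexp (ereal c * eln (ennreal x)) = ennreal (x powr c)"
  using assms by (cases "x = 0") (auto simp: eln_def eexp_def powr_def ennreal_eq_0_iff)

section \<open>A change of measure bound\<close>

text \<open>By convexity: this is the tangent line of \<open>x powr \<alpha>\<close> at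
  \<open>x = s\<close>, solved for \<open>x\<close>, with equality at \<open>x = s\<close>.\<close>

lemma le_powr_tangent:
  fixes x s \<alpha> :: real
  assumes "0 \<le> x" "0 < s" "1 < \<alpha>"
  shows "x \<le> x powr \<alpha> * (s powr (1 - \<alpha>) / \<alpha>) + s * ((\<alpha> - 1) / \<alpha>)"
proof -
  \<comment> \<open>With this \<open>b\<close>, Young's inequality for \<open>x / b\<close> and
    \<open>b\<close>, with exponents \<alpha> and \<open>\<alpha> / (\<alpha> - 1)\<close>, turns
    the second term into a multiple of \<open>s\<close>.\<close>
  define b where "b = s powr ((\<alpha> - 1) / \<alpha>)"
  have b: "0 < b" using assms by (simp add: b_def)
  have "(x / b) * b \<le> (x / b) powr \<alpha> / \<alpha> + b powr (\<alpha> / (\<alpha> - 1)) / (\<alpha> / (\<alpha> - 1))"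
    using assms b by (intro Youngs_inequality) (auto simp: field_simps)
  moreover have "(x / b) powr \<alpha> = x powr \<alpha> * s powr (1 - \<alpha>)"
  proof -
    have "b powr \<alpha> = s powr (\<alpha> - 1)" using assms by (simp add: b_def powr_powr)
    then show ?thesis
      using assms b by (simp add: powr_divide powr_diff)
  qed
  moreover have "b powr (\<alpha> / (\<alpha> - 1)) = s"
    using assms by (simp add: b_def powr_powr)
  ultimately show ?thesis using b by simp
qed

text \<open>Hoelder's inequality for \<open>p\<close> and the indicator of \<open>A\<close>,
  obtained by integrating the tangent bound and optimising the point of tangency.\<close>

lemma emeasure_density_le_powr:
  fixes p :: "'a \<Rightarrow> real"
  assumes R: "finite_measure R" and [measurable]: "p \<in> borel_measurable R" "A \<in> sets R"
    and p: "\<And>w. 0 \<le> p w" and \<alpha>: "1 < \<alpha>"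
    and I: "(\<integral>\<^sup>+w. ennreal (p w powr \<alpha>) \<partial>R) = ennreal i" "0 \<le> i"
  shows "emeasure (density R p) A \<le> ennreal (measure R A powr ((\<alpha> - 1) / \<alpha>) * i powr (1 / \<alpha>))"
proof -
  interpret finite_measure R by fact
  define r where "r = measure R A"
  have dens: "emeasure (density R p) A = (\<integral>\<^sup>+w. ennreal (p w) * indicator A w \<partial>R)"
    by (simp add: emeasure_density)
  show ?thesis
  \<comment> \<open>Here the optimal \<open>s\<close> would be 0 or undefined, but the left side
    vanishes: either \<open>A\<close> is an \<open>R\<close>-null set or \<open>p\<close> is 0
    almost everywhere.\<close>
  proof (cases "i = 0 \<or> r = 0")
    case True
    have "AE w in R. ennreal (p w) * indicator A w = 0"
    proof (cases "r = 0")
      case True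
      then have "A \<in> null_sets R" by (auto simp: r_def emeasure_eq_measure)
      then show ?thesis by (auto dest: AE_not_in)
    next
      case False
      then have "AE w in R. ennreal (p w powr \<alpha>) = 0"
        using True I by (subst nn_integral_0_iff_AE[symmetric]) auto
      then show ?thesis
        by eventually_elim (use p in \<open>auto simp: ennreal_eq_0_iff not_less\<close>)
    qed
    then have "emeasure (density R p) A = 0"
      unfolding dens by (subst nn_integral_0_iff_AE) auto
    then show ?thesis by simp
  next
    case False
    then have i: "0 < i" and r: "0 < r" using I by (auto simp: r_def zero_less_measure_iff)
    \<comment> \<open>This \<open>s\<close> minimises the bound obtained by integrating \<open>le_powr_tangent\<close> over \<open>A\<close>.\<close>
    define s where "s = (i / r) powr (1 / \<alpha>)"
    have s: "0 < s" using i r by (simp add: s_def)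
    define u where "u = s powr (1 - \<alpha>) / \<alpha>"
    define v where "v = s * ((\<alpha> - 1) / \<alpha>)"
    have uv: "0 \<le> u" "0 \<le> v" using s \<alpha> by (auto simp: u_def v_def)
    \<comment> \<open>Only the constant term keeps the indicator; enlarging the other one to the
      whole space makes its integral exactly \<open>i\<close>.\<close>
    have "(\<integral>\<^sup>+w. ennreal (p w) * indicator A w \<partial>R)
        \<le> (\<integral>\<^sup>+w. ennreal (p w powr \<alpha>) * ennreal u + ennreal v * indicator A w \<partial>R)"
    proof (rule nn_integral_mono)
      fix w
      have "p w \<le> p w powr \<alpha> * u + v"
        using le_powr_tangent[OF p s \<alpha>] by (simp add: u_def v_def)
      then have "ennreal (p w) \<le> ennreal (p w powr \<alpha>) * ennreal u + ennreal v"
        using uv by (simp add: ennreal_mult''[symmetric] ennreal_plus[symmetric] del: ennreal_plus)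
      then show "ennreal (p w) * indicator A w
          \<le> ennreal (p w powr \<alpha>) * ennreal u + ennreal v * indicator A w"
        by (auto split: split_indicator)
    qed
    also have "\<dots> = ennreal i * ennreal u + ennreal v * ennreal r"
      by (simp add: nn_integral_add nn_integral_multc nn_integral_cmult I r_def emeasure_eq_measure)
    also have "\<dots> = ennreal (i * u + v * r)"
      using uv i r by (simp add: ennreal_mult)
    also have "i * u + v * r = r powr ((\<alpha> - 1) / \<alpha>) * i powr (1 / \<alpha>)"
    \<comment> \<open>Since \<open>s powr \<alpha> = i / r\<close>, the two terms are the fractions
      \<open>1 / \<alpha>\<close> and \<open>(\<alpha> - 1) / \<alpha>\<close> of
      \<open>s * r\<close>.\<close>
    proof -
      have "s powr (1 - \<alpha>) = s * (r / i)"
      proof -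
        have "s powr (1 - \<alpha>) = s / s powr \<alpha>" using s by (simp add: powr_diff)
        also have "s powr \<alpha> = i / r" using i r \<alpha> by (simp add: s_def powr_powr)
        finally show ?thesis by simp
      qed
      then have "i * u + v * r = s * r"
        using i \<alpha> by (simp add: u_def v_def field_simps)
      also have "s = i powr (1 / \<alpha>) / r powr (1 / \<alpha>)"
        using i r by (simp add: s_def powr_divide)
      also have "r powr ((\<alpha> - 1) / \<alpha>) = r / r powr (1 / \<alpha>)"
        using r \<alpha> by (simp add: diff_divide_distrib powr_diff)
      ultimately show ?thesis by simp
    qed
    finally show ?thesis by (simp add: dens r_def)
  qed
qed

text \<open>The Hoelder bound with \<open>measure R A\<close> relaxed to a positive \<sigma>, so
  that an infinite divergence really gives an infinite right side, in spite of
  \<open>0 * \<infinity> = 0\<close>.\<close>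

lemma emeasure_le_renyi_divergence:
  assumes P: "prob_space P" and R: "prob_space R" and sets: "sets P = sets R"
    and ac: "absolutely_continuous R P" and A: "A \<in> sets R" and \<alpha>: "1 < \<alpha>"
    and \<sigma>: "measure R A \<le> \<sigma>" "0 < \<sigma>"
  shows "emeasure P A \<le> ennreal (\<sigma> powr ((\<alpha> - 1) / \<alpha>))
      * eexp (ereal ((\<alpha> - 1) / \<alpha>) * renyi_divergence \<alpha> P R)"
proof -
  interpret P: prob_space P by fact
  interpret R: prob_space R by fact
  obtain p where [measurable]: "p \<in> borel_measurable R"
    and RN: "AE x in R. RN_deriv R P x = ennreal (p x)" and p: "\<And>x. 0 \<le> p x"
    using R.real_RN_deriv[OF P.finite_measure_axioms ac sets] by metis
  have "P = density R (RN_deriv R P)"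
    using R.density_RN_deriv[OF ac sets] by simp
  also have "\<dots> = density R p"
    using RN by (intro density_cong) auto
  finally have dens: "P = density R p" .
  define J where "J = (\<integral>\<^sup>+w. ennreal (p w powr \<alpha>) \<partial>R)"
  \<comment> \<open>Taking \<open>R\<close> itself as dominating measure, with density 1, reduces
    the Renyi integrand to \<open>p w powr \<alpha>\<close>.\<close>
  have one: "R = density R (\<lambda>_. ennreal 1)" by (simp add: density_1)
  have D: "renyi_divergence \<alpha> P R = ereal (1 / (\<alpha> - 1)) * eln J"
    using renyi_divergence_density[OF R.sigma_finite_measure_axioms _ _ p _ dens P one R] \<alpha> ac
    by (simp add: J_def)
  have "ereal ((\<alpha> - 1) / \<alpha>) * renyi_divergence \<alpha> P R
      = ereal ((\<alpha> - 1) / \<alpha>) * ereal (1 / (\<alpha> - 1)) * eln J"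
    by (simp only: D mult.assoc)
  also have "\<dots> = ereal (1 / \<alpha>) * eln J"
    using \<alpha> by simp
  finally have eq: "ereal ((\<alpha> - 1) / \<alpha>) * renyi_divergence \<alpha> P R = ereal (1 / \<alpha>) * eln J" .
  show ?thesis
  proof (cases J)
    case (real i)
    have "emeasure P A \<le> ennreal (measure R A powr ((\<alpha> - 1) / \<alpha>) * i powr (1 / \<alpha>))"
      unfolding dens using R.finite_measure_axioms A p \<alpha> real
      by (intro emeasure_density_le_powr) (auto simp: J_def)
    also have "\<dots> \<le> ennreal (\<sigma> powr ((\<alpha> - 1) / \<alpha>) * i powr (1 / \<alpha>))"
      using \<sigma> \<alpha> by (intro ennreal_leI mult_right_mono powr_mono2) auto
    also have "\<dots> = ennreal (\<sigma> powr ((\<alpha> - 1) / \<alpha>)) * eexp (ereal (1 / \<alpha>) * eln J)"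
      using \<alpha> real by (simp only: eexp_mult_eln[of "1 / \<alpha>" i] ennreal_mult'' powr_ge_zero
          zero_less_divide_1_iff)
    finally show ?thesis by (simp add: eq)
  next
    case top
    then show ?thesis
      unfolding eq using \<alpha> \<sigma> by (simp add: eln_def eexp_def ennreal_mult_top ennreal_eq_0_iff not_le)
  qed
qed

section \<open>Restricting to fibres of small probability\<close>

lemma measurable_measure_section:
  assumes KX: "KX \<in> MZ \<rightarrow>\<^sub>M prob_algebra MX" and KY: "KY \<in> MZ \<rightarrow>\<^sub>M prob_algebra MY"
    and E: "E \<in> sets (MX \<Otimes>\<^sub>M MY \<Otimes>\<^sub>M MZ)"
  shows "(\<lambda>z. measure (KX z \<Otimes>\<^sub>M KY z) {(x, y). (x, y, z) \<in> E}) \<in> borel_measurable MZ"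
proof -
  note [measurable] = KX KY E
  \<comment> \<open>The measurability rule for kernels expects the parameter as first coordinate,
    hence the reordering.\<close>
  have "(SIGMA z:space MZ. {(x, y). (x, y, z) \<in> E})
      = (\<lambda>(z, x, y). (x, y, z)) -` E \<inter> space (MZ \<Otimes>\<^sub>M MX \<Otimes>\<^sub>M MY)"
    using sets.sets_into_space[OF E] by (auto simp: space_pair_measure)
  also have "\<dots> \<in> sets (MZ \<Otimes>\<^sub>M MX \<Otimes>\<^sub>M MY)"
    by measurable
  finally show ?thesis
    by (rule measure_measurable_subprob_algebra2) (intro measurable_prob_algebraD, measurable)
qed

text \<open>\<open>A\<close> is chosen before \<open>Q\<close>: its sections are small for every
  \<open>z\<close>, not just almost every one, so a single set serves all \<open>Q\<close>.\<close>

lemma obtain_small_fibres: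
  assumes P: "prob_space P" and sets: "sets P = sets (MX \<Otimes>\<^sub>M MY \<Otimes>\<^sub>M MZ)"
    and KX: "KX \<in> MZ \<rightarrow>\<^sub>M prob_algebra MX" and KY: "KY \<in> MZ \<rightarrow>\<^sub>M prob_algebra MY"
    and E: "E \<in> sets P" and \<sigma>: "0 \<le> \<sigma>"
    and AE: "AE z in distr P MZ (\<lambda>(x, y, z). z).
      measure (KX z \<Otimes>\<^sub>M KY z) {(x, y). (x, y, z) \<in> E} \<le> \<sigma>"
  obtains A where "A \<in> sets P" "emeasure P A = emeasure P E"
    "\<And>Q. prob_space Q \<Longrightarrow> sets Q = sets MZ \<Longrightarrow> measure (cond_product MX MY MZ KX KY Q) A \<le> \<sigma>"
proof -
  define g where "g z = measure (KX z \<Otimes>\<^sub>M KY z) {(x, y). (x, y, z) \<in> E}" for z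
  have E': "E \<in> sets (MX \<Otimes>\<^sub>M MY \<Otimes>\<^sub>M MZ)" using E sets by simp
  have [measurable]: "g \<in> borel_measurable MZ"
    unfolding g_def by (rule measurable_measure_section[OF KX KY E'])
  note [measurable_cong] = sets
  note [measurable] = E E'
  define A where "A = {w \<in> space P. w \<in> E \<and> g (snd (snd w)) \<le> \<sigma>}"
  have A: "A \<in> sets P" unfolding A_def by measurable
  have A': "A \<in> sets (MX \<Otimes>\<^sub>M MY \<Otimes>\<^sub>M MZ)" using A sets by simp
  have "AE z in distr P MZ (\<lambda>(x, y, z). z). g z \<le> \<sigma>"
    using AE by (simp add: g_def)
  \<comment> \<open>The law of the third coordinate under \<open>P\<close> is the measure of the
    hypothesis, so the discarded fibres are \<open>P\<close>-null.\<close>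
  then have "AE w in P. g (snd (snd w)) \<le> \<sigma>"
    by (subst (asm) AE_distr_iff) (auto simp: case_prod_beta')
  then have "AE w in P. w \<in> A \<longleftrightarrow> w \<in> E"
    using AE_space by eventually_elim (auto simp: A_def)
  then have "emeasure P A = emeasure P E"
    using A E by (intro emeasure_eq_AE) auto
  moreover have "measure (cond_product MX MY MZ KX KY Q) A \<le> \<sigma>"
    if Q: "prob_space Q" "sets Q = sets MZ" for Q
  proof -
    interpret Q: prob_space Q by fact
    interpret R: prob_space "cond_product MX MY MZ KX KY Q"
      by (rule prob_space_cond_product[OF KX KY Q])
    have "emeasure (KX z \<Otimes>\<^sub>M KY z) {(x, y). (x, y, z) \<in> A} \<le> ennreal \<sigma>" if "z \<in> space Q" for z
    proof -
      have z: "z \<in> space MZ" using that sets_eq_imp_space_eq[OF Q(2)] by simp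
      have "(\<lambda>z. KX z \<Otimes>\<^sub>M KY z) \<in> MZ \<rightarrow>\<^sub>M prob_algebra (MX \<Otimes>\<^sub>M MY)"
        using KX KY by measurable
      from measurable_space[OF this z] interpret K: prob_space "KX z \<Otimes>\<^sub>M KY z"
        by (simp add: space_prob_algebra)
      show ?thesis
      \<comment> \<open>The extra condition in \<open>A\<close> depends on \<open>z\<close> alone,
        so a section of \<open>A\<close> is either the whole section of \<open>E\<close> or
        empty.\<close>
      proof (cases "g z \<le> \<sigma>")
        case True
        then have "{(x, y). (x, y, z) \<in> A} = {(x, y). (x, y, z) \<in> E}"
          using sets.sets_into_space[OF E] by (auto simp: A_def)
        then show ?thesis using True by (simp add: K.emeasure_eq_measure g_def ennreal_leI)
      qed (simp add: A_def)
    qed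
    then have "emeasure (cond_product MX MY MZ KX KY Q) A \<le> (\<integral>\<^sup>+z. ennreal \<sigma> \<partial>Q)"
      unfolding emeasure_cond_product[OF KX KY Q A'] by (rule nn_integral_mono)
    then show ?thesis
      using \<sigma> by (simp add: Q.emeasure_space_1 R.emeasure_eq_measure)
  qed
  ultimately show ?thesis using A that by blast
qed

section \<open>Degenerate cases and passage to the infimum over \<open>Q\<close>\<close>

theorem theorem3:
  fixes MX :: "'x measure" and MY :: "'y measure" and MZ :: "'z measure"
    and P :: "('x \<times> 'y \<times> 'z) measure" and PZ :: "'z measure"
    and KX :: "'z \<Rightarrow> 'x measure" and KY :: "'z \<Rightarrow> 'y measure"
    and E :: "('x \<times> 'y \<times> 'z) set" and \<alpha> :: real
  assumes "prob_space P" and "sets P = sets (MX \<Otimes>\<^sub>M MY \<Otimes>\<^sub>M MZ)"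
    and "PZ = distr P MZ (\<lambda>(x, y, z). z)"
    and "cond_distribution P MX (\<lambda>(x, y, z). x) MZ (\<lambda>(x, y, z). z) KX"
    and "cond_distribution P MY (\<lambda>(x, y, z). y) MZ (\<lambda>(x, y, z). z) KY"
    and "absolutely_continuous (cond_product MX MY MZ KX KY PZ) P"
    and "E \<in> sets P"
    and "\<alpha> \<ge> 1"
  shows "emeasure P E
    \<le> esssup PZ (\<lambda>z. ennreal (rpow (measure (KX z \<Otimes>\<^sub>M KY z) {(x, y). (x, y, z) \<in> E}) ((\<alpha> - 1) / \<alpha>)))
      * eexp (ereal ((\<alpha> - 1) / \<alpha>) * cond_renyi_info MX MY MZ KX KY \<alpha> P)"
proof -
  interpret P: prob_space P by fact
  note sets = assms(2)
  have KX: "KX \<in> MZ \<rightarrow>\<^sub>M prob_algebra MX" and KY: "KY \<in> MZ \<rightarrow>\<^sub>M prob_algebra MY"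
    using assms(4,5) by (simp_all add: cond_distribution_def)
  have Z: "(\<lambda>(x, y, z). z) \<in> P \<rightarrow>\<^sub>M MZ"
    by (subst measurable_cong_sets[OF sets refl]) measurable
  have PZ: "prob_space PZ" "sets PZ = sets MZ"
    using P.prob_space_distr[OF Z] by (simp_all add: assms(3))
  interpret PZ: prob_space PZ by fact
  define g where "g z = measure (KX z \<Otimes>\<^sub>M KY z) {(x, y). (x, y, z) \<in> E}" for z
  define c where "c = (\<alpha> - 1) / \<alpha>"
  define S where "S = esssup PZ (\<lambda>z. ennreal (rpow (g z) c))"
  let ?I = "cond_renyi_info MX MY MZ KX KY \<alpha> P"
  have "emeasure P E \<le> S * eexp (ereal c * ?I)"
  \<comment> \<open>For exponent 0 the convention in \<open>rpow\<close> gives \<open>S = 1\<close>,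
    and \<open>0 * ?I = 0\<close> even for infinite \<open>?I\<close>, so the claim is that a
    probability is at most 1.\<close>
  proof (cases "\<alpha> = 1")
    case True
    then have "S = 1"
      by (simp add: S_def c_def rpow_def esssup_const PZ.emeasure_space_1)
    then show ?thesis
      using True P.emeasure_le_1 by (simp add: c_def zero_ereal_def[symmetric] eexp_0)
  next
    case False
    then have \<alpha>: "1 < \<alpha>" using assms(8) by simp
    then have c: "0 < c" by (simp add: c_def)
    have g: "0 \<le> g z" "z \<in> space MZ \<Longrightarrow> g z \<le> 1" for z
    proof -
      assume z: "z \<in> space MZ"
      have "(\<lambda>z. KX z \<Otimes>\<^sub>M KY z) \<in> MZ \<rightarrow>\<^sub>M prob_algebra (MX \<Otimes>\<^sub>M MY)"
        using KX KY by measurable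
      from measurable_space[OF this z] show "g z \<le> 1"
        unfolding g_def by (intro prob_space.prob_le_1) (simp add: space_prob_algebra)
    qed (simp add: g_def)
    have [measurable]: "g \<in> borel_measurable PZ"
      using measurable_measure_section[OF KX KY] assms(7) sets PZ(2)
      by (simp add: g_def[abs_def] cong: measurable_cong_sets)
    have "S \<le> 1"
      unfolding S_def
    proof (rule esssup_I)
      show "AE z in PZ. ennreal (rpow (g z) c) \<le> 1"
        using g c sets_eq_imp_space_eq[OF PZ(2)]
        by (intro AE_I2) (auto simp: rpow_def powr_le1)
    qed (use c in \<open>simp add: rpow_def\<close>)
    then obtain s where s: "S = ennreal s" "0 \<le> s"
      by (cases S) (auto simp: top_unique)
    \<comment> \<open>Taking the \<open>c\<close>-th root turns the essential bound on
      \<open>g z powr c\<close> into one on \<open>g z\<close>.\<close>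
    define \<sigma> where "\<sigma> = s powr (1 / c)"
    have \<sigma>: "\<sigma> powr c = s" "0 \<le> \<sigma>" using s c by (simp_all add: \<sigma>_def powr_powr)
    have "AE z in PZ. ennreal (rpow (g z) c) \<le> S"
      unfolding S_def by (rule esssup_AE)
    then have AE: "AE z in PZ. g z \<le> \<sigma>"
    proof eventually_elim
      case (elim z)
      then have "g z powr c \<le> \<sigma> powr c" using c s \<sigma> by (simp add: rpow_def)
      then show ?case using powr_less_mono2[OF c \<sigma>(2), of "g z"] by (meson not_le)
    qed
    obtain A where A: "A \<in> sets P" "emeasure P A = emeasure P E"
      and small: "\<And>Q. prob_space Q \<Longrightarrow> sets Q = sets MZ \<Longrightarrow>
        measure (cond_product MX MY MZ KX KY Q) A \<le> \<sigma>"
      using obtain_small_fibres[OF assms(1) sets KX KY assms(7) \<sigma>(2) AE[unfolded assms(3) g_def]]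
      by blast
    show ?thesis
    \<comment> \<open>For \<open>s = 0\<close> the right side is 0 whatever the information is, so
      \<open>E\<close> must be shown \<open>P\<close>-null. This is where the assumed absolute
      continuity enters, with \<open>Q = PZ\<close>.\<close>
    proof (cases "s = 0")
      case True
      interpret R: prob_space "cond_product MX MY MZ KX KY PZ"
        by (rule prob_space_cond_product[OF KX KY PZ])
      have "measure (cond_product MX MY MZ KX KY PZ) A = 0"
        using small[OF PZ] True by (simp add: \<sigma>_def measure_le_0_iff)
      then have "A \<in> null_sets (cond_product MX MY MZ KX KY PZ)"
        using A sets by (auto simp: R.emeasure_eq_measure sets_cond_product[OF KX KY PZ])
      then have "emeasure P A = 0"
        using assms(6) by (auto simp: absolutely_continuous_def)
      then show ?thesis using A by simp
    next
      case False
      then have s0: "0 < s" and \<sigma>0: "0 < \<sigma>" using s by (simp_all add: \<sigma>_def)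
      show ?thesis
        unfolding cond_renyi_info_def
      proof (rule mult_eexp_INF_greatest[OF c])
        show "S \<noteq> 0" "S \<noteq> top" using s s0 by auto
      next
        fix Q assume "Q \<in> {Q. prob_space Q \<and> sets Q = sets MZ}"
        then have Q: "prob_space Q" "sets Q = sets MZ" by auto
        let ?R = "cond_product MX MY MZ KX KY Q"
        show "emeasure P E \<le> S * eexp (ereal c * renyi_divergence \<alpha> P ?R)"
        \<comment> \<open>The hypothesis covers only \<open>PZ\<close>; for another \<open>Q\<close>
          absolute continuity may fail, and then the divergence is infinite and the bound trivial
          because \<open>S\<close> is positive.\<close>
        proof (cases "absolutely_continuous ?R P")
          case True
          have "sets P = sets ?R" using sets by (simp add: sets_cond_product[OF KX KY Q])
          then have "emeasure P A
              \<le> ennreal (\<sigma> powr c) * eexp (ereal c * renyi_divergence \<alpha> P ?R)"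
            unfolding c_def using A True
            by (intro emeasure_le_renyi_divergence[OF assms(1) prob_space_cond_product[OF KX KY Q]
                  _ _ _ \<alpha> small[OF Q] \<sigma>0]) auto
          then show ?thesis using A s \<sigma> by simp
        next
          case False
          then have "renyi_divergence \<alpha> P ?R = \<infinity>"
            using \<alpha> by (simp add: renyi_divergence_def)
          then show ?thesis
            using s s0 c by (simp add: eexp_def ennreal_mult_top ennreal_eq_0_iff not_le)
        qed
      qed
    qed
  qed
  then show ?thesis by (simp only: S_def c_def g_def)
qed

end
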